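(* For any integer $n>3$, any $d>r$ (where $r>0$ is the range of transmission and $d$ is the Geocast eccentricity), any integers $\alpha\ge 0$, $\beta>0$, any $V_{\max}>\pi r/(6\alpha)$, and any oblivious randomized Geocast protocol $\Pi$, there exists an $(\alpha,\beta)$-connected MANET of $n$ nodes (node speeds bounded by $V_{\max}$) for which $\Pi$ takes at least $$\frac{\alpha n}{2}+\frac{n^2}{48e\ln(n/2)}$$ time slots in order to solve the problem with probability at least $2^{-n/2}$.
   Context: **Model.** A MANET is a set $V$ of $n$ nodes in $\mathbb{R}^2$, no two at the same point at the same time. Time is divided into slots $1,2,\dots$; positions (hence topology) change only at slot boundaries, and no node moves faster than $V_{\max}$ (measured as distance per time slot). All nodes have the same range of transmission $r>0$; two nodes are neighbors in a slot if their distance is at most $r$ during the whole slot. An active node $u$ receives a transmission from a neighbor $v$ in a slot if and only if $v$ is the only node transmitting in that slot among $u$ and its neighbors. There is no collision detection. Nodes may be activated at any slot boundary, and may fail (become inactive) and be reactivated; upon activation a node starts its algorithm from scratch, keeping no state. Slots counted from a node's activation are its (local) steps. **Geocast.** A source node $s$ holds a piece of information $I$ at time $t_1$. $I$ must be delivered to all nodes that at time $t_1$ are active and located within distance $d$ (the eccentricity) of the position of $s$ at that time. A node is covered if it has received $I$ (the source counts as covered from $t_1$), otherwise uncovered. A node is informed at time $t$ if it holds $I$ at time $t$. The problem is solved at slot $t_2\ge t_1$ if all target nodes are covered by slot $t_2$; the time taken is counted in slots from $t_1$. **$(\alpha,\beta)$-connectivity** (integers $\alpha\ge0$, $\beta\ge1$).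 For every slot $t\ge t_1$ at which the problem is not yet solved there is a slot $t'$ such that $[t,t+\alpha]\cap[t',t'+\beta)\neq\emptyset$, and there are nodes $p,p'$ such that at time $t'$ $p$ is informed and $p'$ is uncovered, and $p,p'$ are active and neighbors from step $t'$ until $p'$ becomes covered or until step $t'+\beta-1$ (inclusive), whichever occurs first. **Adversary.** Placement, movement and activation schedule (and the instance: source and $t_1$) are chosen by an adaptive adversary, which decides at the end of each slot with access to the protocol and all nodes' internal states but not to future random bits, subject to the speed bound and $(\alpha,\beta)$-connectivity. "There exists an $(\alpha,\beta)$-connected MANET" means that there is such an adversary strategy. Probability is over the protocol's random bits. **Protocols.** Protocols are conditional: a node does not transmit before it is covered. A randomized protocol is oblivious if it is given by a set $\{\pi_i : i\in V\}$ of sequences $\pi_i=\langle\pi_{i1},\pi_{i2},\dots\rangle$ of probabilities such that, in any execution, a covered node $i$ transmits independently with probability $\pi_{it}$ in the $t$-th step after its activation. For $\alpha=0$ the quantity $\pi r/(6\alpha)$ is read as $+\infty$ (there $\pi$ is the circle constant). *)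

theory Defs
  imports "HOL-Probability.Probability"
begin

text \<open>
  Slots are the natural numbers \<open>1, 2, \<dots>\<close>; "time \<open>t\<close>" is the beginning of slot \<open>t\<close>.
  A trace \<open>X :: nat \<Rightarrow> 'v set\<close> gives for every slot \<open>t \<ge> 1\<close> the set of nodes that transmit in it;
  \<open>X 0\<close> is never consulted.
\<close>

record 'v topology =
  position :: "'v \<Rightarrow> real^2"
  active :: "'v set"

text \<open>
  An adaptive adversary fixes the topology of slot \<open>t\<close> from the transmitter sets of the slots
  \<open>1, \<dots>, t - 1\<close>. Together with its own earlier decisions these determine the internal states of all
  nodes (local step counter, possession of the information, past coin tosses), so this argument
  carries all the adversary may know; future coins are excluded by the type.
  The instance, i.e. the source and its start time \<open>t\<^sub>1\<close>, needs no such argument: no node transmits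
  before \<open>t\<^sub>1\<close>, so the past up to \<open>t\<^sub>1\<close> is deterministic.
\<close>

record 'v adversary =
  source :: 'v
  start :: nat
  topology_after :: "'v set list \<Rightarrow> 'v topology"

definition topology_at :: "'v adversary \<Rightarrow> (nat \<Rightarrow> 'v set) \<Rightarrow> nat \<Rightarrow> 'v topology" where
  "topology_at A X t = topology_after A (map X [1..<t])"

definition pos :: "'v adversary \<Rightarrow> (nat \<Rightarrow> 'v set) \<Rightarrow> nat \<Rightarrow> 'v \<Rightarrow> real^2" where
  "pos A X t = position (topology_at A X t)"

definition act :: "'v adversary \<Rightarrow> (nat \<Rightarrow> 'v set) \<Rightarrow> nat \<Rightarrow> 'v set" where
  "act A X t = active (topology_at A X t)"

text \<open>Positions are constant during a slot, so one distance per slot suffices.\<close>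

definition neighbors ::
  "'v set \<Rightarrow> real \<Rightarrow> 'v adversary \<Rightarrow> (nat \<Rightarrow> 'v set) \<Rightarrow> nat \<Rightarrow> 'v \<Rightarrow> 'v set" where
  "neighbors V r A X t u = {v \<in> V. v \<noteq> u \<and> dist (pos A X t u) (pos A X t v) \<le> r}"

definition receives ::
  "'v set \<Rightarrow> real \<Rightarrow> 'v adversary \<Rightarrow> (nat \<Rightarrow> 'v set) \<Rightarrow> nat \<Rightarrow> 'v \<Rightarrow> 'v \<Rightarrow> bool" where
  "receives V r A X t u v \<longleftrightarrow>
     u \<in> act A X t \<and> v \<in> neighbors V r A X t u \<and>
     X t \<inter> insert u (neighbors V r A X t u) = {v}"

text \<open>
  Number of the local step that node \<open>i\<close> performs in slot \<open>t\<close>, counted from its latest activation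
  (the first active slot is step 1); 0 if \<open>i\<close> is inactive.
\<close>

primrec local_step :: "'v adversary \<Rightarrow> (nat \<Rightarrow> 'v set) \<Rightarrow> 'v \<Rightarrow> nat \<Rightarrow> nat" where
  "local_step A X i 0 = 0"
| "local_step A X i (Suc t) = (if i \<in> act A X (Suc t) then Suc (local_step A X i t) else 0)"

text \<open>
  The nodes that have received the information before time \<open>t\<close>, including the source from \<open>t\<^sub>1\<close> on.
  Being covered is never undone, not even by a failure. Only nodes holding the information ever
  transmit (see \<open>transmit_pmf\<close>), so every reception delivers it.
\<close>

primrec covered ::
  "'v set \<Rightarrow> real \<Rightarrow> 'v adversary \<Rightarrow> (nat \<Rightarrow> 'v set) \<Rightarrow> nat \<Rightarrow> 'v set" where
  "covered V r A X 0 = {}"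
| "covered V r A X (Suc t) =
     (if Suc t < start A then {}
      else if Suc t = start A then {source A}
      else covered V r A X t \<union> {u \<in> V. \<exists>v. receives V r A X t u v})"

text \<open>
  The active nodes that hold the information at time \<open>t\<close>. A node that fails loses it, and after
  reactivation regains it only by a new reception.
\<close>

primrec informed ::
  "'v set \<Rightarrow> real \<Rightarrow> 'v adversary \<Rightarrow> (nat \<Rightarrow> 'v set) \<Rightarrow> nat \<Rightarrow> 'v set" where
  "informed V r A X 0 = {}"
| "informed V r A X (Suc t) =
     (if Suc t < start A then {}
      else if Suc t = start A then {source A}
      else {u \<in> V. u \<in> act A X t \<and> u \<in> act A X (Suc t) \<and>
                    (u \<in> informed V r A X t \<or> (\<exists>v. receives V r A X t u v))})"

definition targets :: "'v set \<Rightarrow> real \<Rightarrow> 'v adversary \<Rightarrow> (nat \<Rightarrow> 'v set) \<Rightarrow> 'v set" where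
  "targets V d A X =
     {v \<in> V. v \<in> act A X (start A) \<and>
             dist (pos A X (start A) v) (pos A X (start A) (source A)) \<le> d}"

definition solved ::
  "'v set \<Rightarrow> real \<Rightarrow> real \<Rightarrow> 'v adversary \<Rightarrow> (nat \<Rightarrow> 'v set) \<Rightarrow> nat \<Rightarrow> bool" where
  "solved V r d A X t \<longleftrightarrow> targets V d A X \<subseteq> covered V r A X t"

text \<open>
  In the last line, a slot during which \<open>p'\<close> becomes covered is one at whose beginning \<open>p'\<close> is still
  uncovered, so the link is required in that slot as well.
\<close>

definition connected_trace ::
  "nat \<Rightarrow> nat \<Rightarrow> 'v set \<Rightarrow> real \<Rightarrow> real \<Rightarrow> 'v adversary \<Rightarrow> (nat \<Rightarrow> 'v set) \<Rightarrow> bool" where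
  "connected_trace \<alpha> \<beta> V r d A X \<longleftrightarrow>
     (\<forall>t \<ge> start A. \<not> solved V r d A X t \<longrightarrow>
        (\<exists>t'. {t..t + \<alpha>} \<inter> {t'..<t' + \<beta>} \<noteq> {} \<and>
           (\<exists>p p'. p \<in> informed V r A X t' \<and> p' \<in> V \<and> p' \<notin> covered V r A X t' \<and>
              (\<forall>\<tau> \<in> {t'..<t' + \<beta>}. p' \<notin> covered V r A X \<tau> \<longrightarrow>
                 p \<in> act A X \<tau> \<and> p' \<in> act A X \<tau> \<and> p' \<in> neighbors V r A X \<tau> p))))"

definition oblivious_protocol :: "'v set \<Rightarrow> ('v \<Rightarrow> nat \<Rightarrow> real) \<Rightarrow> bool" where
  "oblivious_protocol V \<pi> \<longleftrightarrow> (\<forall>i \<in> V. \<forall>t \<ge> 1. 0 \<le> \<pi> i t \<and> \<pi> i t \<le> 1)"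

text \<open>Distribution of the set of transmitters in slot \<open>t\<close>, given the transmitters of earlier slots.\<close>

definition transmit_pmf ::
  "'v set \<Rightarrow> real \<Rightarrow> ('v \<Rightarrow> nat \<Rightarrow> real) \<Rightarrow> 'v adversary \<Rightarrow> (nat \<Rightarrow> 'v set) \<Rightarrow> nat \<Rightarrow> 'v set pmf" where
  "transmit_pmf V r \<pi> A X t =
     map_pmf (\<lambda>b. {i \<in> informed V r A X t. b i})
       (Pi_pmf (informed V r A X t) False (\<lambda>i. bernoulli_pmf (\<pi> i (local_step A X i t))))"

text \<open>
  Distribution of the trace of the slots \<open>1, \<dots>, k\<close> (empty in all other slots) when the protocol
  \<open>\<pi>\<close> runs against the adversary \<open>A\<close>.
\<close>

primrec run_pmf ::
  "'v set \<Rightarrow> real \<Rightarrow> ('v \<Rightarrow> nat \<Rightarrow> real) \<Rightarrow> 'v adversary \<Rightarrow> nat \<Rightarrow> (nat \<Rightarrow> 'v set) pmf" where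
  "run_pmf V r \<pi> A 0 = return_pmf (\<lambda>_. {})"
| "run_pmf V r \<pi> A (Suc k) =
     bind_pmf (run_pmf V r \<pi> A k)
       (\<lambda>X. map_pmf (\<lambda>B. X(Suc k := B)) (transmit_pmf V r \<pi> A X (Suc k)))"

definition execution ::
  "'v set \<Rightarrow> real \<Rightarrow> ('v \<Rightarrow> nat \<Rightarrow> real) \<Rightarrow> 'v adversary \<Rightarrow> (nat \<Rightarrow> 'v set) \<Rightarrow> bool" where
  "execution V r \<pi> A X \<longleftrightarrow> (\<forall>t \<ge> 1. X t \<in> set_pmf (transmit_pmf V r \<pi> A X t))"

definition connected_manet ::
  "nat \<Rightarrow> nat \<Rightarrow> 'v set \<Rightarrow> real \<Rightarrow> real \<Rightarrow> real \<Rightarrow> ('v \<Rightarrow> nat \<Rightarrow> real) \<Rightarrow> 'v adversary \<Rightarrow> bool" where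
  "connected_manet \<alpha> \<beta> V r d vmax \<pi> A \<longleftrightarrow>
     source A \<in> V \<and> 1 \<le> start A \<and>
     (\<forall>X. execution V r \<pi> A X \<longrightarrow>
        source A \<in> act A X (start A) \<and>
        (\<forall>t \<ge> 1. act A X t \<subseteq> V \<and> inj_on (pos A X t) V \<and>
           (\<forall>v \<in> V. dist (pos A X t v) (pos A X (Suc t) v) \<le> vmax)) \<and>
        connected_trace \<alpha> \<beta> V r d A X)"

text \<open>
  Probability that all targets are covered by receptions in the first \<open>k\<close> slots
  \<open>t\<^sub>1, \<dots>, t\<^sub>1 + k - 1\<close>.
\<close>

definition solve_prob ::
  "'v set \<Rightarrow> real \<Rightarrow> real \<Rightarrow> ('v \<Rightarrow> nat \<Rightarrow> real) \<Rightarrow> 'v adversary \<Rightarrow> nat \<Rightarrow> real" where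
  "solve_prob V r d \<pi> A k =
     measure_pmf.prob (run_pmf V r \<pi> A (start A + k - 1)) {X. solved V r d A X (start A + k)}"

definition speed_threshold :: "real \<Rightarrow> nat \<Rightarrow> ereal" where
  "speed_threshold r \<alpha> = (if \<alpha> = 0 then \<infinity> else ereal (pi * r / (6 * real \<alpha>)))"

end

theory Submission
  imports Defs
begin

text \<open>
  Half of the nodes form a core \<open>C\<close> of \<open>m = n div 2\<close> nodes, covered first; the others are then covered
  one at a time, each after \<open>\<alpha>\<close> slots without any link. An outer node is active only while it is
  being covered, so it never relays the information. During its phase a fixed core node, the link, is
  always in range, and by tiny movements the adversary decides in every slot whether the rest of the
  core is in range as well. It is, exactly in the slots in which the transmission probabilities of the
  core add up to more than \<open>4 ln m\<close>; the transmissions then collide with high probability. In either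
  case the success probabilities in a slot, summed over all choices of the link, are at most \<open>4 ln m\<close>.
  The core being active from slot 1 on, these probabilities are known in advance, and averaging
  yields a link for which the expected discount \<open>\<rho>^\<tau>\<close> of the phase length \<open>\<tau>\<close> is as small as if every
  slot succeeded with probability \<open>O(ln n / n)\<close>. Multiplying over the phases and applying Markov's
  inequality to \<open>\<rho>\<close> to the total time gives the bound. For \<open>\<alpha> = 0\<close> no speed exceeds the threshold.
\<close>

section \<open>Random sets of transmitters\<close>

definition random_subset :: "'a set \<Rightarrow> ('a \<Rightarrow> real) \<Rightarrow> 'a set pmf" where
  "random_subset I a = map_pmf (\<lambda>b. {i \<in> I. b i}) (Pi_pmf I False (\<lambda>i. bernoulli_pmf (a i)))"

lemma random_subset_cong: "(\<And>i. i \<in> I \<Longrightarrow> a i = b i) \<Longrightarrow> random_subset I a = random_subset I b"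
  unfolding random_subset_def by (intro arg_cong[where f = "map_pmf _"] Pi_pmf_cong) auto

lemma set_random_subset: "B \<in> set_pmf (random_subset I a) \<Longrightarrow> B \<subseteq> I"
  unfolding random_subset_def by auto

lemma prob_random_subset_member:
  assumes "finite I" "i \<in> I" "0 \<le> a i" "a i \<le> 1"
  shows "measure_pmf.prob (random_subset I a) {B. i \<in> B} = a i"
proof -
  have "measure_pmf.prob (random_subset I a) {B. i \<in> B} =
      measure_pmf.prob (Pi_pmf I False (\<lambda>i. bernoulli_pmf (a i))) ((\<lambda>b. b i) -` {True})"
    unfolding random_subset_def measure_map_pmf using assms
    by (intro arg_cong2[where f = measure]) auto
  also have "\<dots> = measure_pmf.prob (map_pmf (\<lambda>b. b i) (Pi_pmf I False (\<lambda>i. bernoulli_pmf (a i)))) {True}"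
    by (simp only: measure_map_pmf)
  also have "\<dots> = a i"
    using assms by (simp add: Pi_pmf_component measure_pmf_single)
  finally show ?thesis .
qed

lemma prob_random_subset_eq_singleton:
  assumes "finite I" "i \<in> I" "\<And>j. j \<in> I \<Longrightarrow> 0 \<le> a j \<and> a j \<le> 1"
  shows "measure_pmf.prob (random_subset I a) {{i}} = a i * (\<Prod>j\<in>I - {i}. 1 - a j)"
proof -
  have "measure_pmf.prob (random_subset I a) {{i}} =
      measure_pmf.prob (Pi_pmf I False (\<lambda>i. bernoulli_pmf (a i))) ((\<lambda>b. {i \<in> I. b i}) -` {{i}})"
    unfolding random_subset_def measure_map_pmf ..
  also have "\<dots> = measure_pmf.prob (Pi_pmf I False (\<lambda>i. bernoulli_pmf (a i)))
      {\<lambda>j. j = i}"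
  proof (rule measure_pmf.finite_measure_eq_AE)
    show "AE b in Pi_pmf I False (\<lambda>i. bernoulli_pmf (a i)).
      (b \<in> (\<lambda>b. {i \<in> I. b i}) -` {{i}}) = (b \<in> {\<lambda>j. j = i})"
    proof (rule AE_pmfI)
      fix b assume "b \<in> set_pmf (Pi_pmf I False (\<lambda>i. bernoulli_pmf (a i)))"
      then have *: "\<not> b j" if "j \<notin> I" for j using set_Pi_pmf_subset[OF assms(1)] that by fast
      show "(b \<in> (\<lambda>b. {i \<in> I. b i}) -` {{i}}) = (b \<in> {\<lambda>j. j = i})"
        using * assms(2) by (fastforce simp: fun_eq_iff)
    qed
  qed auto
  also have "\<dots> = (\<Prod>j\<in>I. pmf (bernoulli_pmf (a j)) (j = i))"
    using assms by (subst measure_pmf_single, subst pmf_Pi') auto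
  also have "\<dots> = pmf (bernoulli_pmf (a i)) True * (\<Prod>j\<in>I - {i}. pmf (bernoulli_pmf (a j)) (j = i))"
    using assms by (subst prod.remove[of I i]) auto
  also have "(\<Prod>j\<in>I - {i}. pmf (bernoulli_pmf (a j)) (j = i)) = (\<Prod>j\<in>I - {i}. 1 - a j)"
    using assms by (intro prod.cong) auto
  finally show ?thesis using assms by simp
qed

lemma prob_random_subset_card_1:
  assumes "finite I" "\<And>j. j \<in> I \<Longrightarrow> 0 \<le> a j \<and> a j \<le> 1"
  shows "measure_pmf.prob (random_subset I a) {B. card (B \<inter> I) = 1} \<le> exp 1 * sum a I * exp (- sum a I)"
proof -
  have "measure_pmf.prob (random_subset I a) {B. card (B \<inter> I) = 1} \<le>
      measure_pmf.prob (random_subset I a) (\<Union>i\<in>I. {{i}})"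
  proof (rule measure_pmf.finite_measure_mono_AE)
    show "AE B in random_subset I a. B \<in> {B. card (B \<inter> I) = 1} \<longrightarrow> B \<in> (\<Union>i\<in>I. {{i}})"
    proof (rule AE_pmfI, rule impI)
      fix B assume "B \<in> set_pmf (random_subset I a)" and B: "B \<in> {B. card (B \<inter> I) = 1}"
      then have "B \<inter> I = B" using set_random_subset by fast
      with B show "B \<in> (\<Union>i\<in>I. {{i}})" by (auto simp: card_1_singleton_iff)
    qed
  qed auto
  also have "\<dots> \<le> (\<Sum>i\<in>I. measure_pmf.prob (random_subset I a) {{i}})"
    using assms(1) by (intro measure_pmf.finite_measure_subadditive_finite) auto
  also have "\<dots> = (\<Sum>i\<in>I. a i * (\<Prod>j\<in>I - {i}. 1 - a j))"
    using assms by (intro sum.cong refl prob_random_subset_eq_singleton) auto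
  also have "\<dots> \<le> (\<Sum>i\<in>I. a i * (exp 1 * exp (- sum a I)))"
  proof (intro sum_mono mult_left_mono)
    fix i assume i: "i \<in> I"
    have "(\<Prod>j\<in>I - {i}. 1 - a j) \<le> (\<Prod>j\<in>I - {i}. exp (- a j))"
      using assms exp_ge_add_one_self[of "- a _"] by (intro prod_mono) (auto simp: algebra_simps)
    also have "\<dots> = exp (a i - sum a I)"
      using assms(1) i by (simp add: exp_sum[symmetric] sum_negf sum.remove[of I i])
    also have "\<dots> \<le> exp (1 - sum a I)" using assms(2)[OF i] by simp
    finally show "(\<Prod>j\<in>I - {i}. 1 - a j) \<le> exp 1 * exp (- sum a I)"
      by (simp add: exp_add[symmetric])
  qed (use assms in auto)
  also have "\<dots> = exp 1 * sum a I * exp (- sum a I)" by (simp add: sum_distrib_left sum_distrib_right mult_ac)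
  finally show ?thesis .
qed

section \<open>The adversary\<close>

text \<open>
  The adversary is in phase \<open>(j, e)\<close>: phase 0 covers the core, phase \<open>j \<le> N\<close> covers \<open>u j\<close>, and \<open>e\<close> is
  the first slot in which the phase provides a link.
\<close>

locale shuttle =
  fixes V C :: "'v set" and s :: 'v and u :: "nat \<Rightarrow> 'v" and N \<alpha> :: nat
    and h :: "'v \<Rightarrow> real" and r \<epsilon> :: real and crowd :: "nat \<Rightarrow> bool" and link :: "nat \<Rightarrow> 'v"
  assumes C_subset: "C \<subseteq> V" and s_in_C: "s \<in> C"
    and outer: "bij_betw u {1..N} (V - C)" and N_pos: "1 \<le> N" and card_C: "2 \<le> card C"
    and alpha_pos: "1 \<le> \<alpha>"
    and h_inj: "inj_on h V" and h_bounds: "\<And>v. v \<in> V \<Longrightarrow> 0 < h v \<and> h v < \<epsilon>"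
    and eps_pos: "0 < \<epsilon>" and eps_le: "3 * \<epsilon> \<le> r"
    and link_in_C: "\<And>e. link e \<in> C"
begin

definition speakers :: "nat \<Rightarrow> nat \<Rightarrow> nat \<Rightarrow> 'v set" where
  "speakers j e t = (if j = 0 then {s} else if crowd t then C else {link e})"

definition advance :: "nat \<times> nat \<Rightarrow> nat \<Rightarrow> 'v set \<Rightarrow> nat \<times> nat" where
  "advance p t B = (case p of (j, e) \<Rightarrow>
     if j \<le> N \<and> e \<le> t \<and> card (B \<inter> speakers j e t) = 1 then (Suc j, t + \<alpha> + 1) else (j, e))"

text \<open>The most recent slot comes first in this list.\<close>

primrec phase_of_history :: "'v set list \<Rightarrow> nat \<times> nat" where
  "phase_of_history [] = (0, 1)"
| "phase_of_history (B # Bs) = advance (phase_of_history Bs) (Suc (length Bs)) B"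

definition near :: "nat \<times> nat \<Rightarrow> nat \<Rightarrow> 'v set" where
  "near p t = (case p of (j, e) \<Rightarrow> if j = 0 then {} else speakers j e t)"

definition coord :: "'v set \<Rightarrow> 'v \<Rightarrow> real" where
  "coord S v = (if v \<in> C then (if v \<in> S then r - \<epsilon> else r + \<epsilon>) else 0) + h v"

text \<open>\<open>u N\<close> is active in slot 1 only to become a target; no node in its range transmits then.\<close>

definition awake :: "nat \<times> nat \<Rightarrow> nat \<Rightarrow> 'v set" where
  "awake p t = (case p of (j, e) \<Rightarrow>
     C \<union> (if t = 1 then {u N} else {}) \<union> (if 1 \<le> j \<and> j \<le> N \<and> e \<le> t then {u j} else {}))"

definition adv :: "'v adversary" where
  "adv = \<lparr>source = s, start = 1, topology_after = (\<lambda>Bs.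
     let t = Suc (length Bs); p = phase_of_history (rev Bs)
     in \<lparr>position = (\<lambda>v. axis 1 (coord (near p t) v)), active = awake p t\<rparr>)\<rparr>"

definition phase :: "(nat \<Rightarrow> 'v set) \<Rightarrow> nat \<Rightarrow> nat \<times> nat" where
  "phase X t = phase_of_history (rev (map X [1..<t]))"

definition cov :: "nat \<Rightarrow> 'v set" where
  "cov j = (if j = 0 then {s} else C \<union> u ` {1..<j})"

definition holders :: "nat \<Rightarrow> 'v set" where
  "holders j = (if j = 0 then {s} else C)"

definition legal :: "(nat \<Rightarrow> 'v set) \<Rightarrow> nat \<Rightarrow> bool" where
  "legal X t \<longleftrightarrow> (\<forall>i\<in>{1..<t}. X i \<subseteq> holders (fst (phase X i)))"

lemma source_adv [simp]: "source adv = s" and start_adv [simp]: "start adv = 1"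
  by (simp_all add: adv_def)

lemma phase_1 [simp]: "phase X (Suc 0) = (0, 1)" by (simp add: phase_def)

lemma phase_Suc: "1 \<le> t \<Longrightarrow> phase X (Suc t) = advance (phase X t) t (X t)"
  by (simp add: phase_def)

lemma phase_cong: "(\<And>i. 1 \<le> i \<Longrightarrow> i < t \<Longrightarrow> X i = Y i) \<Longrightarrow> phase X t = phase Y t"
  unfolding phase_def by (intro arg_cong[where f = "\<lambda>x. phase_of_history (rev x)"] map_cong) auto

lemma legal_Suc:
  "1 \<le> t \<Longrightarrow> legal X (Suc t) \<longleftrightarrow> legal X t \<and> X t \<subseteq> holders (fst (phase X t))"
  by (auto simp: legal_def atLeastLessThanSuc)

lemma legal_cong:
  assumes "\<And>i. 1 \<le> i \<Longrightarrow> i < t \<Longrightarrow> X i = Y i" shows "legal X t \<longleftrightarrow> legal Y t"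
proof -
  have "phase X i = phase Y i" if "i < t" for i using assms that by (intro phase_cong) auto
  then show ?thesis using assms unfolding legal_def by auto
qed

lemma pos_adv: "1 \<le> t \<Longrightarrow> pos adv X t v = axis 1 (coord (near (phase X t) t) v)"
  and act_adv: "1 \<le> t \<Longrightarrow> act adv X t = awake (phase X t) t"
  by (simp_all add: pos_def act_def topology_at_def adv_def Let_def phase_def)

lemma dist_axis: "dist (axis i x :: real^2) (axis i y) = \<bar>x - y\<bar>"
proof -
  have "axis i x - axis i y = (axis i (x - y) :: real^2)" by (simp add: vec_eq_iff axis_def)
  then show ?thesis by (simp add: dist_norm norm_eq_sqrt_inner inner_axis_axis)
qed

lemma neighbors_adv:
  "1 \<le> t \<Longrightarrow> neighbors V r adv X t v =
     {w \<in> V. w \<noteq> v \<and> \<bar>coord (near (phase X t) t) v - coord (near (phase X t) t) w\<bar> \<le> r}"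
  by (simp add: neighbors_def pos_adv dist_axis)

lemma core_close: "v \<in> C \<Longrightarrow> w \<in> C \<Longrightarrow> \<bar>coord S v - coord S w\<bar> \<le> r"
  using h_bounds[of v] h_bounds[of w] C_subset eps_le eps_pos
  by (auto simp: coord_def subset_iff)

lemma core_outer_close:
  "v \<in> C \<Longrightarrow> w \<in> V - C \<Longrightarrow> \<bar>coord S v - coord S w\<bar> \<le> r \<longleftrightarrow> v \<in> S"
  using h_bounds[of v] h_bounds[of w] C_subset eps_le eps_pos
  by (auto simp: coord_def subset_iff)

lemma inj_coord: "inj_on (coord S) V"
proof (rule inj_onI)
  fix v w assume vw: "v \<in> V" "w \<in> V" "coord S v = coord S w"
  have "h v = h w"
    using vw h_bounds[of v] h_bounds[of w] eps_le eps_pos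
    by (auto simp: coord_def split: if_splits)
  then show "v = w" using h_inj vw by (auto dest: inj_onD)
qed

lemma coord_move: "\<bar>coord S v - coord S' v\<bar> \<le> 2 * \<epsilon>"
  using eps_pos by (auto simp: coord_def)

lemma outer_in: "1 \<le> j \<Longrightarrow> j \<le> N \<Longrightarrow> u j \<in> V - C"
  using outer by (auto simp: bij_betw_def)

lemma outer_eq_iff: "1 \<le> i \<Longrightarrow> i \<le> N \<Longrightarrow> 1 \<le> j \<Longrightarrow> j \<le> N \<Longrightarrow> u i = u j \<longleftrightarrow> i = j"
  using outer by (auto simp: bij_betw_def dest: inj_onD)

lemma outer_fresh: "1 \<le> j \<Longrightarrow> j \<le> N \<Longrightarrow> i \<le> j \<Longrightarrow> u j \<notin> u ` {1..<i}"
  using outer_eq_iff[of _ j] by fastforce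

lemma core_in_awake: "v \<in> C \<Longrightarrow> v \<in> awake p t" by (auto simp: awake_def split: prod.splits)

lemma awake_subset: "awake p t \<subseteq> V"
  using outer_in C_subset N_pos by (auto simp: awake_def split: prod.splits if_splits)

lemma holders_subset: "holders j \<subseteq> C" using s_in_C by (auto simp: holders_def)

lemma advance_cases: "fst (advance p t B) = fst p \<and> advance p t B = p \<or>
   fst (advance p t B) = Suc (fst p) \<and> fst p \<le> N \<and> snd p \<le> t \<and> snd (advance p t B) = t + \<alpha> + 1
     \<and> card (B \<inter> speakers (fst p) (snd p) t) = 1"
  by (auto simp: advance_def split: prod.splits)

lemma phase_bounds:
  assumes "1 \<le> t"
  shows "fst (phase X t) \<le> Suc N \<and> (fst (phase X t) = 0 \<longrightarrow> snd (phase X t) = 1)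
    \<and> snd (phase X t) \<le> t + \<alpha>"
  using assms
proof (induction t rule: dec_induct)
  case (step t)
  then show ?case
    using advance_cases[of "phase X t" t "X t"] by (auto simp: phase_Suc)
qed (use alpha_pos in auto)

lemma phase_mono:
  assumes "t \<le> t'" "1 \<le> t"
  shows "phase X t' = phase X t \<or> fst (phase X t) < fst (phase X t')"
  using assms
proof (induction t' rule: dec_induct)
  case (step t')
  then show ?case
    using advance_cases[of "phase X t'" t' "X t'"] by (auto simp: phase_Suc)
qed auto

lemma phase_wait:
  assumes "t \<le> t'" "1 \<le> t" "t' \<le> snd (phase X t)"
  shows "phase X t' = phase X t"
  using assms
proof (induction t' rule: dec_induct)
  case (step t')
  then show ?case
    using advance_cases[of "phase X t'" t' "X t'"] by (auto simp: phase_Suc)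
qed auto

lemma local_step_core: "i \<in> C \<Longrightarrow> local_step adv X i t = t"
  by (induction t) (simp_all add: act_adv core_in_awake)

lemma receives_outer:
  assumes t: "1 \<le> t" and p: "phase X t = (j, e)" and X: "X t \<subseteq> holders j" and v: "v \<in> V - C"
  shows "(\<exists>w. receives V r adv X t v w) \<longleftrightarrow>
    1 \<le> j \<and> j \<le> N \<and> e \<le> t \<and> v = u j \<and> card (X t \<inter> speakers j e t) = 1"
proof -
  have XC: "X t \<subseteq> C" using X holders_subset by blast
  have inter: "X t \<inter> insert v (neighbors V r adv X t v) = X t \<inter> near (j, e) t"
  proof -
    have "w \<in> neighbors V r adv X t v \<longleftrightarrow> w \<in> near (j, e) t" if "w \<in> C" for w
      using that v C_subset core_outer_close[of w v "near (j, e) t"]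
      by (auto simp: neighbors_adv[OF t] p abs_minus_commute)
    then show ?thesis using XC v by blast
  qed
  have "(\<exists>w. receives V r adv X t v w) \<longleftrightarrow> v \<in> awake (j, e) t \<and> card (X t \<inter> near (j, e) t) = 1"
  proof -
    have "w \<in> neighbors V r adv X t v" if "X t \<inter> near (j, e) t = {w}" for w
    proof -
      have "w \<in> X t \<inter> insert v (neighbors V r adv X t v)" unfolding inter that by simp
      then show ?thesis using XC v by auto
    qed
    then have "receives V r adv X t v w \<longleftrightarrow> v \<in> awake (j, e) t \<and> X t \<inter> near (j, e) t = {w}" for w
      unfolding receives_def inter act_adv[OF t] p by blast
    then show ?thesis by (simp add: card_1_singleton_iff)
  qed
  moreover have "near (j, e) t = {}" if "t = 1"
    using that p by (simp add: near_def)
  ultimately show ?thesis using v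
    by (auto simp: awake_def near_def split: if_splits)
qed

lemma receives_init:
  assumes t: "1 \<le> t" and p: "phase X t = (0, e)" and X: "X t \<subseteq> {s}" and v: "v \<in> C - {s}"
  shows "(\<exists>w. receives V r adv X t v w) \<longleftrightarrow> card (X t \<inter> {s}) = 1"
proof -
  have s: "s \<in> neighbors V r adv X t v" using v s_in_C C_subset core_close by (auto simp: neighbors_adv[OF t])
  have "v \<in> act adv X t" using v by (simp add: act_adv[OF t] core_in_awake)
  then have "(\<exists>w. receives V r adv X t v w) \<longleftrightarrow> (\<exists>w. w \<in> neighbors V r adv X t v \<and> X t = {w})"
    unfolding receives_def using X s v by blast
  also have "\<dots> \<longleftrightarrow> X t = {s}" using X s by auto
  also have "\<dots> \<longleftrightarrow> card (X t \<inter> {s}) = 1" using X by (auto simp: card_1_singleton_iff)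
  finally show ?thesis .
qed

lemma covered_informed:
  assumes "1 \<le> t" "legal X t"
  shows "covered V r adv X t = cov (fst (phase X t)) \<and> informed V r adv X t = holders (fst (phase X t))"
  using assms
proof (induction t rule: dec_induct)
  case base
  then show ?case by (simp add: cov_def holders_def)
next
  case (step t)
  obtain j e where p: "phase X t = (j, e)" by fastforce
  have leg: "legal X t" and X: "X t \<subseteq> holders j"
    using step.prems step.hyps p by (auto simp: legal_Suc)
  have IH: "covered V r adv X t = cov j" "informed V r adv X t = holders j"
    using step.IH[OF leg] p by auto
  define R where "R = {v \<in> V. \<exists>w. receives V r adv X t v w}"
  define ok where "ok \<longleftrightarrow> j \<le> N \<and> e \<le> t \<and> card (X t \<inter> speakers j e t) = 1"
  have p': "phase X (Suc t) = (if ok then (Suc j, t + \<alpha> + 1) else (j, e))"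
    using step.hyps p by (simp add: phase_Suc advance_def ok_def)
  have j0: "j = 0 \<Longrightarrow> e = 1" "e \<le> t + \<alpha>" using phase_bounds[of t X] step.hyps p by auto
  have cov': "covered V r adv X (Suc t) = cov j \<union> R" using step.hyps IH by (simp add: R_def)
  have inf': "informed V r adv X (Suc t) =
      {v \<in> V. v \<in> awake (j, e) t \<and> v \<in> awake (phase X (Suc t)) (Suc t) \<and> (v \<in> holders j \<or> v \<in> R)}"
    using step.hyps IH p by (auto simp: R_def act_adv)
  have R_outer: "v \<in> R \<longleftrightarrow> 1 \<le> j \<and> ok \<and> v = u j" if "v \<in> V - C" for v
    using receives_outer[OF step.hyps(1) p X that] that by (auto simp: R_def ok_def)
  have R_sub: "R \<subseteq> V" by (auto simp: R_def)
  have C_aw: "v \<in> C \<Longrightarrow> v \<in> awake q i" for v q i using core_in_awake by blast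
  show ?case
  proof (cases "j = 0")
    case True
    have "v \<in> R \<longleftrightarrow> ok" if "v \<in> C - {s}" for v
      using receives_init[of t X e v] that X p True step.hyps j0 C_subset
      by (auto simp: R_def ok_def holders_def speakers_def)
    then have R: "insert s R = (if ok then C else {s})"
      using R_outer R_sub s_in_C True C_subset by (auto split: if_splits)
    have "informed V r adv X (Suc t) = insert s R"
    proof -
      have "v \<in> C" if "v \<in> insert s R" for v using that R s_in_C by (auto split: if_splits)
      then show ?thesis
        using C_aw[of _ "(j, e)" t] C_aw[of _ "phase X (Suc t)" "Suc t"] C_subset True
        unfolding inf' by (auto simp: holders_def)
    qed
    then show ?thesis using cov' True R p' by (auto simp: cov_def holders_def)
  next
    case False
    have "cov j \<union> R = cov (fst (phase X (Suc t)))"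
    proof -
      have "ok \<Longrightarrow> u j \<in> V - C" using False outer_in by (auto simp: ok_def)
      then have "C \<union> R = (if ok then insert (u j) C else C)"
        using R_outer R_sub False by auto
      moreover have "{1..<Suc j} = insert j {1..<j}" using False by auto
      ultimately show ?thesis using False p' by (auto simp: cov_def)
    qed
    moreover have "informed V r adv X (Suc t) = C"
    proof -
      have "v \<notin> awake (phase X (Suc t)) (Suc t)" if "v \<in> R" "v \<in> V - C" for v
        using R_outer[OF that(2)] that step.hyps p' alpha_pos by (auto simp: awake_def)
      then show ?thesis
        using C_aw[of _ "(j, e)" t] C_aw[of _ "phase X (Suc t)" "Suc t"] C_subset R_sub False
        unfolding inf' by (auto simp: holders_def)
    qed
    ultimately show ?thesis using cov' False p' by (auto simp: holders_def)
  qed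
qed

lemma execution_legal:
  assumes "execution V r \<pi> adv X" shows "legal X t"
proof (induction t)
  case (Suc t)
  have "X t \<subseteq> holders (fst (phase X t))" if "1 \<le> t"
  proof -
    have "X t \<subseteq> informed V r adv X t" using assms that by (auto simp: execution_def transmit_pmf_def)
    then show ?thesis using covered_informed[OF that Suc] by simp
  qed
  with Suc show ?case by (cases "t = 0") (simp add: legal_def, simp add: legal_Suc)
qed (simp add: legal_def)

lemma solved_iff:
  assumes "1 \<le> t" "legal X t" "r + 2 * \<epsilon> \<le> d"
  shows "solved V r d adv X t \<longleftrightarrow> fst (phase X t) = Suc N"
proof -
  have uN: "u N \<in> V - C" using outer_in N_pos by blast
  have "\<bar>coord {} (u N) - coord {} s\<bar> \<le> r + 2 * \<epsilon>"
    using h_bounds[of s] h_bounds[of "u N"] uN s_in_C C_subset eps_pos eps_le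
    by (auto simp: coord_def subset_iff)
  then have target: "u N \<in> targets V d adv X" "targets V d adv X \<subseteq> V"
    using uN assms(3) by (auto simp: targets_def act_adv pos_adv awake_def near_def dist_axis)
  have "cov (Suc N) = V"
    using outer C_subset by (auto simp: cov_def bij_betw_def atLeastLessThanSuc_atLeastAtMost)
  moreover have "u N \<notin> cov j" if "j \<noteq> Suc N" "j \<le> Suc N" for j
    using that uN N_pos s_in_C outer_fresh[of N j] by (auto simp: cov_def)
  ultimately have "targets V d adv X \<subseteq> cov j \<longleftrightarrow> j = Suc N" if "j \<le> Suc N" for j
    using target that by (metis subset_eq)
  then show ?thesis
    using covered_informed[OF assms(1,2)] phase_bounds[OF assms(1), of X] by (simp add: solved_def)
qed

lemma connected_adv:
  assumes "execution V r \<pi> adv X" "0 < \<beta>" "r + 2 * \<epsilon> \<le> d"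
  shows "connected_trace \<alpha> \<beta> V r d adv X"
  unfolding connected_trace_def
proof (intro allI impI)
  fix t assume t: "start adv \<le> t" and ns: "\<not> solved V r d adv X t"
  note leg = execution_legal[OF assms(1)]
  note ci = covered_informed[OF _ leg]
  obtain j e where p: "phase X t = (j, e)" by fastforce
  have j: "j \<le> N" "e \<le> t + \<alpha>" "j = 0 \<Longrightarrow> e = 1"
    using solved_iff[OF _ leg assms(3), of t] ns t phase_bounds[of t X] p by auto
  define t' where "t' = max t e"
  have p': "phase X t' = (j, e)"
    using phase_wait[of t t' X] t p by (auto simp: t'_def max_def)
  define v where "v = (if j = 0 then s else link e)"
  obtain w0 where w0: "w0 \<in> C - {s}"
  proof -
    have "C \<noteq> {s}" using card_C by auto
    then show ?thesis using that s_in_C by blast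
  qed
  define w where "w = (if j = 0 then w0 else u j)"
  have v: "v \<in> C" using s_in_C link_in_C by (auto simp: v_def)
  have w: "w \<in> V" using w0 C_subset outer_in j by (auto simp: w_def)
  have t'1: "1 \<le> t'" using t by (auto simp: t'_def)
  have stay: "w \<notin> covered V r adv X \<tau> \<Longrightarrow> phase X \<tau> = (j, e)" if "t' \<le> \<tau>" for \<tau>
  proof -
    assume "w \<notin> covered V r adv X \<tau>"
    then have "w \<notin> cov (fst (phase X \<tau>))" using ci[of \<tau>] that t'1 by auto
    then have "\<not> j < fst (phase X \<tau>)" using w0 by (auto simp: w_def cov_def split: if_splits)
    then show ?thesis using phase_mono[OF that t'1, of X] p' by auto
  qed
  have link_ok: "v \<in> act adv X \<tau> \<and> w \<in> act adv X \<tau> \<and> w \<in> neighbors V r adv X \<tau> v"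
    if "t' \<le> \<tau>" "w \<notin> covered V r adv X \<tau>" for \<tau>
  proof -
    have \<tau>: "1 \<le> \<tau>" "e \<le> \<tau>" using that t'1 by (auto simp: t'_def)
    have ph: "phase X \<tau> = (j, e)" using stay that by blast
    have vw: "v \<noteq> w" using w0 link_in_C[of e] outer_in[of j] j by (auto simp: v_def w_def)
    have "w \<in> awake (j, e) \<tau>"
      using w0 j \<tau> by (auto simp: w_def awake_def)
    moreover have "\<bar>coord (near (j, e) \<tau>) v - coord (near (j, e) \<tau>) w\<bar> \<le> r"
    proof (cases "j = 0")
      case True
      then show ?thesis using core_close[OF v] w0 by (auto simp: w_def)
    next
      case False
      then have "v \<in> near (j, e) \<tau>" using v by (auto simp: near_def speakers_def v_def)
      moreover have "w \<in> V - C" using False j outer_in by (auto simp: w_def)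
      ultimately show ?thesis using core_outer_close[OF v] by blast
    qed
    ultimately show ?thesis
      using v w vw by (simp add: act_adv[OF \<tau>(1)] neighbors_adv[OF \<tau>(1)] ph core_in_awake)
  qed
  have unc: "w \<notin> covered V r adv X t'"
  proof (cases "j = 0")
    case True
    then show ?thesis using ci[OF t'1] p' w0 by (simp add: w_def cov_def)
  next
    case False
    then have "w \<in> V - C" "w \<notin> u ` {1..<j}"
      using j outer_in[of j] outer_fresh[of j j] by (auto simp: w_def)
    then show ?thesis using False ci[OF t'1] p' by (simp add: cov_def)
  qed
  have "v \<in> informed V r adv X t'"
    using ci[OF t'1] p' v by (auto simp: holders_def v_def)
  moreover have "{t..t + \<alpha>} \<inter> {t'..<t' + \<beta>} \<noteq> {}"
    using j assms(2) by (auto simp: t'_def disjoint_iff intro!: exI[of _ "max t e"])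
  ultimately show "\<exists>t'. {t..t + \<alpha>} \<inter> {t'..<t' + \<beta>} \<noteq> {} \<and>
           (\<exists>p p'. p \<in> informed V r adv X t' \<and> p' \<in> V \<and> p' \<notin> covered V r adv X t' \<and>
              (\<forall>\<tau> \<in> {t'..<t' + \<beta>}. p' \<notin> covered V r adv X \<tau> \<longrightarrow>
                 p \<in> act adv X \<tau> \<and> p' \<in> act adv X \<tau> \<and> p' \<in> neighbors V r adv X \<tau> p))"
    using unc w link_ok
    by - (rule exI[of _ t'], rule conjI, assumption, rule exI[of _ v], rule exI[of _ w], simp)
qed

lemma connected_manet_adv:
  assumes "0 < \<beta>" "r + 2 * \<epsilon> \<le> d" "2 * \<epsilon> \<le> vmax"
  shows "connected_manet \<alpha> \<beta> V r d vmax \<pi> adv"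
  unfolding connected_manet_def
proof (intro conjI allI impI ballI)
  fix X t v assume X: "execution V r \<pi> adv X"
  show "connected_trace \<alpha> \<beta> V r d adv X" using connected_adv X assms by blast
  show "source adv \<in> act adv X (start adv)" using s_in_C by (simp add: act_adv core_in_awake)
  assume t: "(1::nat) \<le> t"
  show "act adv X t \<subseteq> V" using awake_subset[of "phase X t" t] unfolding act_adv[OF t] .
  show "inj_on (pos adv X t) V"
  proof (rule inj_onI)
    fix v w assume "v \<in> V" "w \<in> V" "pos adv X t v = pos adv X t w"
    moreover from this have "coord (near (phase X t) t) v = coord (near (phase X t) t) w"
      by (auto simp: pos_adv[OF t] axis_eq_axis)
    ultimately show "v = w" using inj_onD[OF inj_coord] by blast
  qed
  assume "v \<in> V"
  show "dist (pos adv X t v) (pos adv X (Suc t) v) \<le> vmax"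
    using order_trans[OF coord_move assms(3)] t by (simp add: pos_adv[OF t] pos_adv dist_axis)
next
  show "source adv \<in> V" "1 \<le> start adv" using s_in_C C_subset by auto
qed

end

section \<open>Discounted success probabilities\<close>

locale shuttle_potential = shuttle V C s u N \<alpha> h r \<epsilon> crowd link
  for V C :: "'v set" and s u N \<alpha> h r \<epsilon> crowd link +
  fixes \<pi> :: "'v \<Rightarrow> nat \<Rightarrow> real" and w :: "nat \<Rightarrow> nat \<Rightarrow> real" and H :: nat and \<rho> Q :: real
  assumes discount: "0 < \<rho>" "\<rho> \<le> 1"
    and success_prob: "\<And>e t. 1 \<le> t \<Longrightarrow>
      measure_pmf.prob (random_subset C (\<lambda>i. \<pi> i t)) {B. card (B \<inter> speakers 1 e t) = 1} \<le> w e t"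
    and discounted: "\<And>e. 1 \<le> e \<Longrightarrow> (\<Sum>t\<in>{e..H}. w e t * \<rho> ^ t) \<le> \<rho> ^ (e - 1) * Q"
begin

definition tail :: "nat \<Rightarrow> nat \<Rightarrow> real" where
  "tail e t = (\<Sum>i\<in>{max t e..H}. w e i * \<rho> ^ i)"

text \<open>
  An upper bound on the expectation of \<open>\<rho>\<close> to the slot of the last success, given the phase before
  slot \<open>t\<close>; once all nodes are covered, that slot is \<open>e - \<alpha> - 1\<close>.
\<close>

definition potential :: "nat \<times> nat \<Rightarrow> nat \<Rightarrow> real" where
  "potential p t = (case p of (j, e) \<Rightarrow>
     if j = 0 then \<rho> ^ t * (\<rho> ^ \<alpha> * Q) ^ N
     else if j \<le> N then tail e t * (\<rho> ^ \<alpha> * Q) ^ (N - j)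
     else \<rho> ^ (e - \<alpha> - 1))"

lemma w_nonneg: "1 \<le> t \<Longrightarrow> 0 \<le> w e t"
  using success_prob[of t e] measure_nonneg order_trans by blast

lemma tail_nonneg: "1 \<le> t \<Longrightarrow> 0 \<le> tail e t"
  unfolding tail_def using w_nonneg discount by (intro sum_nonneg mult_nonneg_nonneg) auto

lemma Q_nonneg: "0 \<le> Q"
proof -
  have "0 \<le> (\<Sum>t\<in>{1..H}. w 1 t * \<rho> ^ t)"
    using w_nonneg discount by (intro sum_nonneg mult_nonneg_nonneg) auto
  then show ?thesis using discounted[of 1] by simp
qed

lemma potential_success:
  assumes "j \<le> N"
  shows "potential (Suc j, t + \<alpha> + 1) (Suc t) \<le> \<rho> ^ t * (\<rho> ^ \<alpha> * Q) ^ (N - j)"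
proof (cases "j = N")
  case True
  then show ?thesis by (simp add: potential_def)
next
  case False
  then have *: "N - j = Suc (N - Suc j)" "Suc j \<le> N" using assms by auto
  have "tail (t + \<alpha> + 1) (Suc t) \<le> \<rho> ^ (t + \<alpha>) * Q"
    using discounted[of "t + \<alpha> + 1"] by (simp add: tail_def max_def)
  then have "tail (t + \<alpha> + 1) (Suc t) * (\<rho> ^ \<alpha> * Q) ^ (N - Suc j) \<le>
      \<rho> ^ (t + \<alpha>) * Q * (\<rho> ^ \<alpha> * Q) ^ (N - Suc j)"
    using Q_nonneg discount by (intro mult_right_mono) auto
  also have "\<dots> = \<rho> ^ t * (\<rho> ^ \<alpha> * Q) ^ (N - j)"
    unfolding *(1) by (simp add: power_add)
  finally show ?thesis using * by (simp add: potential_def)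
qed

lemma transmit_adv:
  assumes "1 \<le> t" "legal X t"
  shows "transmit_pmf V r \<pi> adv X t = random_subset (holders (fst (phase X t))) (\<lambda>i. \<pi> i t)"
proof -
  have "transmit_pmf V r \<pi> adv X t =
      random_subset (holders (fst (phase X t))) (\<lambda>i. \<pi> i (local_step adv X i t))"
    unfolding transmit_pmf_def random_subset_def using covered_informed[OF assms] by simp
  also have "\<dots> = random_subset (holders (fst (phase X t))) (\<lambda>i. \<pi> i t)"
    using holders_subset local_step_core by (intro random_subset_cong) (metis subsetD)
  finally show ?thesis .
qed

lemma run_legal: "X \<in> set_pmf (run_pmf V r \<pi> adv k) \<Longrightarrow> legal X (Suc k)"
proof (induction k arbitrary: X)
  case (Suc k)
  then obtain Y B where Y: "Y \<in> set_pmf (run_pmf V r \<pi> adv k)"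
    and B: "B \<in> set_pmf (transmit_pmf V r \<pi> adv Y (Suc k))" and X: "X = Y(Suc k := B)"
    by auto
  have leg: "legal Y (Suc k)" using Suc.IH Y by blast
  have "legal X (Suc k) = legal Y (Suc k)" "phase X (Suc k) = phase Y (Suc k)"
    unfolding X by (intro legal_cong phase_cong; simp)+
  moreover have "X (Suc k) \<subseteq> holders (fst (phase Y (Suc k)))"
    using B set_random_subset transmit_adv[OF _ leg] by (simp add: X)
  ultimately show ?case using leg by (simp add: legal_Suc)
qed (simp add: legal_def)

lemma potential_step:
  assumes t: "1 \<le> t" "t \<le> H" and leg: "legal X t"
  shows "(\<integral>\<^sup>+B. ennreal (potential (advance (phase X t) t B) (Suc t)) \<partial>transmit_pmf V r \<pi> adv X t)
    \<le> ennreal (potential (phase X t) t)"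
proof -
  obtain j e where p: "phase X t = (j, e)" by fastforce
  have j0: "j = 0 \<Longrightarrow> e = 1" using phase_bounds[of t X] t p by auto
  let ?M = "transmit_pmf V r \<pi> adv X t"
  let ?\<theta> = "\<rho> ^ \<alpha> * Q"
  have \<theta>: "0 \<le> ?\<theta>" using discount Q_nonneg by auto
  have const: ?thesis if "\<And>B. potential (advance (j, e) t B) (Suc t) \<le> potential (j, e) t"
  proof -
    have "(\<integral>\<^sup>+B. ennreal (potential (advance (phase X t) t B) (Suc t)) \<partial>?M) \<le>
        (\<integral>\<^sup>+B. ennreal (potential (j, e) t) \<partial>?M)"
      using that p by (intro nn_integral_mono ennreal_leI) auto
    then show ?thesis using p by simp
  qed
  consider (idle) "N < j \<or> t < e" | (init) "j = 0" "e \<le> t" | (active) "1 \<le> j" "j \<le> N" "e \<le> t"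
    by linarith
  then show ?thesis
  proof cases
    case idle
    then show ?thesis
      using j0 t by (intro const) (auto simp: advance_def potential_def tail_def max_def)
  next
    case init
    show ?thesis
    proof (rule const)
      fix B
      have "\<rho> ^ Suc t * ?\<theta> ^ N \<le> \<rho> ^ t * ?\<theta> ^ N"
        using discount \<theta> by (intro mult_right_mono power_decreasing) auto
      then show "potential (advance (j, e) t B) (Suc t) \<le> potential (j, e) t"
        using potential_success[of 0 t] init
        by (auto simp: advance_def potential_def[of "(0, _)"])
    qed
  next
    case active
    define S where "S = {B. card (B \<inter> speakers 1 e t) = 1}"
    define x where "x = \<rho> ^ t * ?\<theta> ^ (N - j)"
    define y where "y = tail e (Suc t) * ?\<theta> ^ (N - j)"
    have x: "0 \<le> x" and y: "0 \<le> y"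
      using discount \<theta> tail_nonneg[of "Suc t" e] by (auto simp: x_def y_def)
    have M: "?M = random_subset C (\<lambda>i. \<pi> i t)"
      using transmit_adv[OF t(1) leg] active p by (simp add: holders_def)
    have le: "potential (advance (j, e) t B) (Suc t) \<le> x * indicator S B + y" for B
    proof (cases "B \<in> S")
      case True
      then have "advance (j, e) t B = (Suc j, t + \<alpha> + 1)"
        using active by (auto simp: advance_def S_def speakers_def)
      then show ?thesis using True potential_success[of j t] active y by (simp add: x_def)
    next
      case False
      then have "advance (j, e) t B = (j, e)"
        using active by (auto simp: advance_def S_def speakers_def)
      then show ?thesis using False active by (simp add: potential_def y_def)
    qed
    have "(\<integral>\<^sup>+B. ennreal (potential (advance (phase X t) t B) (Suc t)) \<partial>?M) \<le>
        (\<integral>\<^sup>+B. ennreal x * indicator S B + ennreal y \<partial>?M)"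
    proof (intro nn_integral_mono)
      fix B
      have "ennreal (x * indicator S B + y) = ennreal x * indicator S B + ennreal y"
        using x y by (simp split: split_indicator)
      then show "ennreal (potential (advance (phase X t) t B) (Suc t)) \<le>
          ennreal x * indicator S B + ennreal y"
        using ennreal_leI[OF le[of B]] p by simp
    qed
    also have "\<dots> = ennreal x * emeasure ?M S + ennreal y"
      by (simp add: nn_integral_add nn_integral_cmult_indicator)
    also have "\<dots> = ennreal (x * measure_pmf.prob ?M S + y)"
      using x y by (simp add: measure_pmf.emeasure_eq_measure ennreal_mult)
    also have "\<dots> \<le> ennreal (x * w e t + y)"
      using success_prob[OF t(1), of e] x unfolding M S_def
      by (intro ennreal_leI add_right_mono mult_left_mono)
    also have "x * w e t + y = potential (j, e) t"
    proof -
      have "{t..H} = insert t {Suc t..H}" using t by auto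
      then have "tail e t = w e t * \<rho> ^ t + tail e (Suc t)"
        using active by (simp add: tail_def max_def)
      then show ?thesis using active by (simp add: potential_def x_def y_def algebra_simps)
    qed
    finally show ?thesis using p by simp
  qed
qed

lemma expected_potential:
  "k \<le> H \<Longrightarrow> (\<integral>\<^sup>+X. ennreal (potential (phase X (Suc k)) (Suc k)) \<partial>run_pmf V r \<pi> adv k)
     \<le> ennreal ((\<rho> ^ \<alpha> * Q) ^ N)"
proof (induction k)
  case 0
  have "\<rho> * (\<rho> ^ \<alpha> * Q) ^ N \<le> 1 * (\<rho> ^ \<alpha> * Q) ^ N"
    using discount Q_nonneg by (intro mult_right_mono) auto
  then show ?case by (simp add: potential_def ennreal_leI)
next
  case (Suc k)
  have "(\<integral>\<^sup>+X. ennreal (potential (phase X (Suc (Suc k))) (Suc (Suc k))) \<partial>run_pmf V r \<pi> adv (Suc k)) =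
    (\<integral>\<^sup>+X. (\<integral>\<^sup>+B. ennreal (potential (phase (X(Suc k := B)) (Suc (Suc k))) (Suc (Suc k)))
       \<partial>transmit_pmf V r \<pi> adv X (Suc k)) \<partial>run_pmf V r \<pi> adv k)"
    by simp
  also have "\<dots> \<le> (\<integral>\<^sup>+X. ennreal (potential (phase X (Suc k)) (Suc k)) \<partial>run_pmf V r \<pi> adv k)"
  proof (intro nn_integral_mono_AE AE_pmfI)
    fix X assume X: "X \<in> set_pmf (run_pmf V r \<pi> adv k)"
    have "phase (X(Suc k := B)) (Suc (Suc k)) = advance (phase X (Suc k)) (Suc k) B" for B
      using phase_cong[of "Suc k" "X(Suc k := B)" X] by (simp add: phase_Suc)
    then show "(\<integral>\<^sup>+B. ennreal (potential (phase (X(Suc k := B)) (Suc (Suc k))) (Suc (Suc k)))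
       \<partial>transmit_pmf V r \<pi> adv X (Suc k)) \<le> ennreal (potential (phase X (Suc k)) (Suc k))"
      using potential_step[OF _ _ run_legal[OF X]] Suc.prems by simp
  qed
  also have "\<dots> \<le> ennreal ((\<rho> ^ \<alpha> * Q) ^ N)" using Suc by simp
  finally show ?case .
qed

lemma solve_prob_le:
  assumes "k \<le> H" "r + 2 * \<epsilon> \<le> d"
  shows "solve_prob V r d \<pi> adv k * \<rho> ^ k \<le> (\<rho> ^ \<alpha> * Q) ^ N"
proof -
  let ?M = "run_pmf V r \<pi> adv k"
  let ?S = "{X. solved V r d adv X (Suc k)}"
  have "ennreal (solve_prob V r d \<pi> adv k * \<rho> ^ k) = (\<integral>\<^sup>+X. ennreal (\<rho> ^ k) * indicator ?S X \<partial>?M)"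
    using discount
    by (simp add: solve_prob_def nn_integral_cmult_indicator measure_pmf.emeasure_eq_measure
        ennreal_mult mult.commute)
  also have "\<dots> \<le> (\<integral>\<^sup>+X. ennreal (potential (phase X (Suc k)) (Suc k)) \<partial>?M)"
  proof (intro nn_integral_mono_AE AE_pmfI)
    fix X assume X: "X \<in> set_pmf ?M"
    have "\<rho> ^ k \<le> potential (phase X (Suc k)) (Suc k)" if "X \<in> ?S"
    proof -
      have "fst (phase X (Suc k)) = Suc N"
        using that solved_iff[OF _ run_legal[OF X] assms(2)] by simp
      moreover have "snd (phase X (Suc k)) \<le> Suc k + \<alpha>" using phase_bounds[of "Suc k" X] by simp
      ultimately show ?thesis
        using discount by (auto simp: potential_def intro!: power_decreasing split: prod.splits)
    qed
    then show "ennreal (\<rho> ^ k) * indicator ?S X \<le> ennreal (potential (phase X (Suc k)) (Suc k))"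
      by (auto simp: ennreal_leI split: split_indicator)
  qed
  also have "\<dots> \<le> ennreal ((\<rho> ^ \<alpha> * Q) ^ N)" by (rule expected_potential[OF assms(1)])
  finally show ?thesis using discount Q_nonneg by (subst (asm) ennreal_le_iff) auto
qed

end

section \<open>Choice of the links\<close>

lemma crowd_sum_bound:
  fixes x :: real and m :: nat
  assumes "2 \<le> m" "4 * ln m < x"
  shows "m * (exp 1 * x * exp (- x)) \<le> 4 * ln m"
proof -
  have m: "0 < real m" using assms by simp
  have ln2: "1 / 2 \<le> ln (real m)"
  proof -
    have "ln 2 \<le> ln (real m)" using assms by simp
    then show ?thesis using ln2_ge_two_thirds by linarith
  qed
  have "x / 2 \<le> exp (x / 2 - 1)" using exp_ge_add_one_self[of "x / 2 - 1"] by simp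
  then have "exp 1 * x * exp (- x) \<le> exp 1 * (2 * exp (x / 2 - 1)) * exp (- x)"
    by (intro mult_right_mono mult_left_mono) auto
  also have "\<dots> = 2 * exp (1 + (x / 2 - 1) + (- x))" by (simp only: exp_add mult_ac)
  also have "\<dots> = 2 * exp (- (x / 2))" by simp
  also have "\<dots> \<le> 2 * exp (- (ln m + ln m))" using assms by simp
  also have "\<dots> = 2 / (m * m)" using m by (simp only: exp_minus exp_add exp_ln divide_inverse of_nat_mult)
  finally have "m * (exp 1 * x * exp (- x)) \<le> m * (2 / (m * m))" using m by (intro mult_left_mono) auto
  also have "\<dots> \<le> 1" using assms by (simp add: field_simps)
  also have "\<dots> \<le> 4 * ln m" using ln2 by simp
  finally show ?thesis .
qed

lemma geometric_sum_le:
  fixes x :: real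
  assumes "0 < x" "1 \<le> e"
  shows "(\<Sum>t\<in>{e..H}. (1 / (1 + x)) ^ t) \<le> (1 / (1 + x)) ^ (e - 1) / x"
proof -
  define \<rho> where "\<rho> = 1 / (1 + x)"
  have \<rho>: "0 < \<rho>" "\<rho> * (1 + x) = 1" using assms by (simp_all add: \<rho>_def)
  have "x * (\<Sum>t\<in>{e..H}. \<rho> ^ t) \<le> \<rho> ^ (e - 1)"
  proof (cases "e \<le> H")
    case True
    then have "x * (\<Sum>t\<in>{e..H}. \<rho> ^ t) = \<rho> ^ (e - 1) - \<rho> ^ H"
    proof (induction H rule: dec_induct)
      case base
      obtain f where "e = Suc f" using assms(2) by (cases e) auto
      moreover have "\<rho> ^ f * (\<rho> * (1 + x)) = \<rho> ^ f" unfolding \<rho>(2) by simp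
      ultimately show ?case by (simp add: algebra_simps)
    next
      case (step H)
      have "\<rho> ^ H * (\<rho> * (1 + x)) = \<rho> ^ H" unfolding \<rho>(2) by simp
      then have "x * \<rho> ^ Suc H = \<rho> ^ H - \<rho> ^ Suc H"
        by (simp add: algebra_simps)
      then show ?case using step by (simp add: sum.nat_ivl_Suc' distrib_left)
    qed
    then show ?thesis using \<rho>(1) by simp
  qed (use \<rho> assms in auto)
  then show ?thesis using assms by (simp add: \<rho>_def[symmetric] pos_le_divide_eq mult.commute)
qed

lemma exponent_tradeoff:
  fixes P Q R x :: real and k N \<alpha> :: nat
  assumes "0 < R" "1 \<le> N" "0 < Q" "Q * exp 1 \<le> 1 / 2" and x: "x = N / R"
    and k: "real k < \<alpha> * N + R"
    and P: "P * (1 / (1 + x)) ^ k \<le> ((1 / (1 + x)) ^ \<alpha> * Q) ^ N"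
  shows "P < (1 / 2) ^ N"
proof -
  have x0: "0 < x" using assms by simp
  have "P \<le> Q ^ N * ((1 + x) ^ k / (1 + x) ^ (\<alpha> * N))"
    using P x0 by (simp add: field_simps power_divide flip: power_mult)
  also have "(1 + x) ^ k / (1 + x) ^ (\<alpha> * N) = (1 + x) powr (real k - real (\<alpha> * N))"
    using x0 by (simp only: powr_diff powr_realpow add_pos_pos zero_less_one)
  also have "\<dots> < (1 + x) powr R" using k x0 by (intro powr_less_mono) auto
  also have "\<dots> = exp (R * ln (1 + x))" using x0 by (simp add: powr_def)
  also have "\<dots> \<le> exp (R * x)" using x0 assms(1) ln_add_one_self_le_self[of x] by simp
  also have "\<dots> = exp 1 ^ N" using assms by (simp add: exp_of_nat_mult[symmetric])
  finally have "P < Q ^ N * exp 1 ^ N" using assms(3) by simp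
  also have "\<dots> = (Q * exp 1) ^ N" by (simp add: power_mult_distrib)
  also have "\<dots> \<le> (1 / 2) ^ N" using assms by (intro power_mono) auto
  finally show ?thesis .
qed

lemma ex_low_success_link:
  fixes w :: "'a \<Rightarrow> nat \<Rightarrow> real" and q :: real
  assumes "finite C" "C \<noteq> {}" "0 < x" "1 \<le> e" "0 \<le> q"
    and w: "\<And>t. 1 \<le> t \<Longrightarrow> (\<Sum>c\<in>C. w c t) \<le> card C * q"
  shows "\<exists>c\<in>C. (\<Sum>t\<in>{e..H}. w c t * (1 / (1 + x)) ^ t) \<le> (1 / (1 + x)) ^ (e - 1) * (q / x)"
proof (rule ccontr)
  let ?\<rho> = "1 / (1 + x)"
  let ?b = "?\<rho> ^ (e - 1) * (q / x)"
  assume "\<not> ?thesis"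
  then have "(\<Sum>c\<in>C. ?b) < (\<Sum>c\<in>C. \<Sum>t\<in>{e..H}. w c t * ?\<rho> ^ t)"
    using assms(1,2) by (intro sum_strict_mono) (auto simp: not_le)
  also have "\<dots> = (\<Sum>t\<in>{e..H}. (\<Sum>c\<in>C. w c t) * ?\<rho> ^ t)"
    by (subst sum.swap) (simp add: sum_distrib_right)
  also have "\<dots> \<le> (\<Sum>t\<in>{e..H}. (card C * q) * ?\<rho> ^ t)"
    using w assms by (intro sum_mono mult_right_mono) auto
  also have "\<dots> = card C * q * (\<Sum>t\<in>{e..H}. ?\<rho> ^ t)" by (simp add: sum_distrib_left)
  also have "\<dots> \<le> card C * q * (?\<rho> ^ (e - 1) / x)"
    using geometric_sum_le[of x e H] assms by (intro mult_left_mono) auto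
  finally show False by (simp add: mult_ac)
qed

theorem theorem10:
  fixes V :: "'v set" and n \<alpha> \<beta> :: nat and r d vmax :: real
    and \<pi> :: "'v \<Rightarrow> nat \<Rightarrow> real"
  assumes "finite V" and "card V = n" and "n > 3"
    and "r > 0" and "d > r"
    and "\<beta> > 0"
    and "ereal vmax > speed_threshold r \<alpha>"
    and "oblivious_protocol V \<pi>"
  shows "\<exists>A :: 'v adversary. connected_manet \<alpha> \<beta> V r d vmax \<pi> A \<and>
           (\<forall>k :: nat. solve_prob V r d \<pi> A k \<ge> 2 powr (- real n / 2) \<longrightarrow>
              real k \<ge> real \<alpha> * real n / 2 + (real n)^2 / (48 * exp 1 * ln (real n / 2)))"
proof -
  have \<alpha>: "1 \<le> \<alpha>" using assms(7) by (cases "\<alpha> = 0") (auto simp: speed_threshold_def)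
  then have "pi * r / (6 * real \<alpha>) < vmax" using assms(7) by (simp add: speed_threshold_def)
  moreover have "0 < pi * r / (6 * real \<alpha>)" using \<alpha> assms(4) by simp
  ultimately have vmax: "0 < vmax" by linarith

  define m where "m = n div 2"
  define N where "N = n - m"
  have m: "2 \<le> m" "n \<le> 3 * m" "2 * m \<le> n" using assms(3) by (auto simp: m_def)
  have N: "1 \<le> N" "n \<le> 2 * N" using assms(3) by (auto simp: m_def N_def)
  obtain C where C: "C \<subseteq> V" "card C = m"
    using obtain_subset_with_card_n[of m V] assms(2) m by (metis add_leD1 mult_2)
  have fin_C: "finite C" using C assms(1) finite_subset by blast
  obtain s where s: "s \<in> C" using C m by fastforce
  have "card (V - C) = N" using C fin_C assms(2) by (simp add: card_Diff_subset N_def)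
  then obtain u where u: "bij_betw u {1..N} (V - C)"
    using ex_bij_betw_nat_finite_1[of "V - C"] assms(1) by auto

  define \<epsilon> where "\<epsilon> = min (r / 3) (min (vmax / 2) ((d - r) / 2))"
  have \<epsilon>: "0 < \<epsilon>" "3 * \<epsilon> \<le> r" "2 * \<epsilon> \<le> vmax" "r + 2 * \<epsilon> \<le> d"
  proof -
    have "\<epsilon> \<le> r / 3" "\<epsilon> \<le> vmax / 2" "\<epsilon> \<le> (d - r) / 2"
      unfolding \<epsilon>_def by linarith+
    then show "3 * \<epsilon> \<le> r" "2 * \<epsilon> \<le> vmax" "r + 2 * \<epsilon> \<le> d" by simp_all
    show "0 < \<epsilon>" using assms vmax by (auto simp: \<epsilon>_def)
  qed
  obtain f where f: "bij_betw f V {0..<n}"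
    using ex_bij_betw_finite_nat[OF assms(1)] assms(2) by auto
  define h where "h v = \<epsilon> * ((real (f v) + 1) / (real n + 1))" for v
  have h: "0 < h v \<and> h v < \<epsilon>" if "v \<in> V" for v
    using bij_betwE[OF f] that \<epsilon>(1) by (auto simp: h_def field_simps intro!: add_pos_nonneg)
  have h_inj: "inj_on h V"
    using f \<epsilon>(1) by (auto simp: h_def bij_betw_def inj_on_def)

  define R where "R = (real n)^2 / (48 * exp 1 * ln (real n / 2))"
  define q where "q = 12 * ln (real n / 2) / n"
  define x where "x = N / R"
  define H where "H = nat \<lceil>real \<alpha> * real n / 2 + R\<rceil>"
  have ln_pos: "0 < ln (real n / 2)" using assms(3) by simp
  have pos: "0 < R" "0 < q" using ln_pos assms(3) by (simp_all add: R_def q_def)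
  have x: "0 < x" using pos N by (simp add: x_def)
  have mq: "4 * ln m \<le> m * q"
  proof -
    have "ln (real m) \<le> ln (real n / 2)" using m by (intro ln_mono) auto
    then have "4 * ln m * n \<le> 4 * ln (real n / 2) * (3 * m)"
      using m ln_pos by (intro mult_mono) auto
    then show ?thesis using assms(3) by (simp add: q_def field_simps)
  qed
  have \<pi>: "0 \<le> \<pi> i t \<and> \<pi> i t \<le> 1" if "i \<in> C" "1 \<le> t" for i t
    using assms(8) C that by (auto simp: oblivious_protocol_def)

  define \<sigma> where "\<sigma> t = (\<Sum>i\<in>C. \<pi> i t)" for t
  define crowd where "crowd t \<longleftrightarrow> 4 * ln m < \<sigma> t" for t
  define wt where "wt c t = (if crowd t then exp 1 * \<sigma> t * exp (- \<sigma> t) else \<pi> c t)" for c t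
  have "(\<Sum>c\<in>C. wt c t) \<le> card C * q" for t
  proof (cases "crowd t")
    case True
    then show ?thesis
      using crowd_sum_bound[OF m(1), of "\<sigma> t"] mq C by (simp add: wt_def crowd_def)
  next
    case False
    then have "(\<Sum>c\<in>C. wt c t) = \<sigma> t" by (simp add: wt_def \<sigma>_def)
    then show ?thesis using False mq C by (simp add: crowd_def)
  qed
  then have "\<exists>c\<in>C. 1 \<le> e \<longrightarrow>
      (\<Sum>t\<in>{e..H}. wt c t * (1 / (1 + x)) ^ t) \<le> (1 / (1 + x)) ^ (e - 1) * (q / x)" for e
    using ex_low_success_link[OF fin_C _ x, where e = e and q = q and w = wt and H = H] s pos by (cases "1 \<le> e") auto
  then obtain link where link: "link e \<in> C"
    "1 \<le> e \<Longrightarrow> (\<Sum>t\<in>{e..H}. wt (link e) t * (1 / (1 + x)) ^ t) \<le> (1 / (1 + x)) ^ (e - 1) * (q / x)" for e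
    by metis

  interpret shuttle V C s u N \<alpha> h r \<epsilon> crowd link
    by (rule shuttle.intro[OF C(1) s u N(1) _ \<alpha> h_inj h \<epsilon>(1,2) link(1)])
      (use C(2) m(1) in simp)
  interpret shuttle_potential V C s u N \<alpha> h r \<epsilon> crowd link \<pi> "\<lambda>e t. wt (link e) t" H "1 / (1 + x)" "q / x"
  proof
    fix e t :: nat assume t: "1 \<le> t"
    show "measure_pmf.prob (random_subset C (\<lambda>i. \<pi> i t)) {B. card (B \<inter> speakers 1 e t) = 1} \<le> wt (link e) t"
    proof (cases "crowd t")
      case True
      then show ?thesis
        using prob_random_subset_card_1[OF fin_C, of "\<lambda>i. \<pi> i t"] \<pi> t
        by (simp add: speakers_def wt_def \<sigma>_def)
    next
      case False
      have "{B. card (B \<inter> {link e}) = 1} = {B. link e \<in> B}"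
        by (simp add: Int_insert_right)
      then show ?thesis
        using False prob_random_subset_member[OF fin_C link(1), of "\<lambda>i. \<pi> i t"] \<pi>[OF link(1) t]
        by (simp add: speakers_def wt_def)
    qed
  qed (use x link(2) in auto)

  have "real k \<ge> real \<alpha> * real n / 2 + R" if "solve_prob V r d \<pi> adv k \<ge> 2 powr (- real n / 2)" for k
  proof (rule ccontr)
    assume "\<not> ?thesis"
    then have k: "real k < real \<alpha> * real n / 2 + R" by simp
    then have "k \<le> H" unfolding H_def by linarith
    note le = solve_prob_le[OF this \<epsilon>(4)]
    have "real \<alpha> * real n / 2 \<le> real \<alpha> * real N" using N mult_left_mono[of "real n" "2 * real N" "real \<alpha>"] by simp
    with k have "real k < \<alpha> * N + R" by simp
    moreover have "q / x * exp 1 \<le> 1 / 2"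
    proof -
      have "q / x * exp 1 = n / 4 / N"
        using ln_pos N assms(3) by (simp add: q_def x_def R_def power2_eq_square)
      also have "\<dots> \<le> 1 / 2" using N by (simp add: field_simps)
      finally show ?thesis .
    qed
    ultimately have "solve_prob V r d \<pi> adv k < (1 / 2) ^ N"
      using exponent_tradeoff[OF pos(1) N(1) _ _ x_def _ le] pos x by simp
    also have "(1 / 2) ^ N = 2 powr (- real N)"
      by (simp only: powr_minus powr_realpow zero_less_numeral power_one_over inverse_eq_divide)
    also have "\<dots> \<le> 2 powr (- real n / 2)" using N by (intro powr_mono) auto
    finally show False using that by simp
  qed
  then show ?thesis
    using connected_manet_adv[OF assms(6) \<epsilon>(4,3)] unfolding R_def by blast
qed

end
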